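(* Let $G$ be a finite graph. If there exist cliques $S_1,S_2,\dots,S_k$ in $G$ such that $S_1\cup S_2\cup\dots\cup S_k$ is a dominating set of $G$, then $c_b(G)\le k$.
   Context: Bridge-burning Cops and Robbers is played on a finite graph $G$ by a team of cops and a single robber, with full information. First each cop chooses a starting vertex (several cops may share a vertex), then the robber chooses a starting vertex. The game then proceeds in rounds; in each round, first every cop either stays put or moves along an edge of the current graph to an adjacent vertex, and then the robber either stays put or moves along an edge of the current graph. Every edge traversed by the robber is immediately deleted from the graph (cop moves delete nothing). The cops win if at some moment some cop occupies the same vertex as the robber; the robber wins if he avoids this forever. $c_b(G)$ is the minimum number of cops for which the cops have a winning strategy. A set $S\subseteq V(G)$ is dominating if every vertex of $G$ is in $S$ or has a neighbor in $S$. *)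

theory Defs
  imports "HOL-Library.Ramsey"
begin

text \<open>A finite simple graph has vertex set \<open>V\<close> and a set \<open>E\<close> of two-element subsets of \<open>V\<close>
  as edges. Cliques are those of the library, \<^const>\<open>clique\<close>.\<close>

definition finite_graph :: "'a set \<Rightarrow> 'a set set \<Rightarrow> bool" where
  "finite_graph V E \<longleftrightarrow> finite V \<and> E \<subseteq> nsets V 2"

definition dominating_set :: "'a set \<Rightarrow> 'a set set \<Rightarrow> 'a set \<Rightarrow> bool" where
  "dominating_set V E D \<longleftrightarrow> D \<subseteq> V \<and> (\<forall>v\<in>V. v \<in> D \<or> (\<exists>u\<in>D. {u, v} \<in> E))"

text \<open>Edges contain two distinct vertices, so the two disjuncts are exclusive in a simple graph.\<close>

definition stay_or_move :: "'a set set \<Rightarrow> 'a \<Rightarrow> 'a \<Rightarrow> bool" where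
  "stay_or_move E u v \<longleftrightarrow> v = u \<or> {u, v} \<in> E"

text \<open>A robber trajectory \<open>R\<close> gives his starting vertex \<open>R 0\<close> and his position \<open>R t\<close> after
  round \<open>t\<close>. The edges left after \<open>t\<close> rounds are those he has not traversed; a round in which he
  stays put contributes the singleton \<open>{R s}\<close>, which is not an edge.\<close>

definition remaining_edges :: "'a set set \<Rightarrow> (nat \<Rightarrow> 'a) \<Rightarrow> nat \<Rightarrow> 'a set set" where
  "remaining_edges E R t = E - {{R s, R (Suc s)} | s. s < t}"

definition robber_play :: "'a set \<Rightarrow> 'a set set \<Rightarrow> (nat \<Rightarrow> 'a) \<Rightarrow> bool" where
  "robber_play V E R \<longleftrightarrow>
     R 0 \<in> V \<and> (\<forall>t. stay_or_move (remaining_edges E R t) (R t) (R (Suc t)))"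

text \<open>A strategy \<open>\<sigma>\<close> for the cops maps the sequence of robber positions seen so far to the list of
  their own next positions (one entry per cop): \<open>\<sigma> []\<close> is the initial placement, chosen before the
  robber appears, and \<open>\<sigma> [R 0, \<dots>, R t]\<close> are the positions after the cops' move in round \<open>t + 1\<close>.
  The cops' own past positions and the current graph are determined by \<open>\<sigma>\<close> and the robber's
  past positions, so this is a strategy depending on the full history of the game.\<close>

definition cops_at :: "('a list \<Rightarrow> 'a list) \<Rightarrow> (nat \<Rightarrow> 'a) \<Rightarrow> nat \<Rightarrow> 'a list" where
  "cops_at \<sigma> R t = \<sigma> (map R [0..<t])"

definition cop_strategy ::
    "'a set \<Rightarrow> 'a set set \<Rightarrow> nat \<Rightarrow> ('a list \<Rightarrow> 'a list) \<Rightarrow> bool" where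
  "cop_strategy V E k \<sigma> \<longleftrightarrow>
     length (\<sigma> []) = k \<and> set (\<sigma> []) \<subseteq> V \<and>
     (\<forall>R. robber_play V E R \<longrightarrow>
        (\<forall>t. list_all2 (stay_or_move (remaining_edges E R t))
               (cops_at \<sigma> R t) (cops_at \<sigma> R (Suc t))))"

text \<open>Capture can occur after the placement or a robber move (first disjunct), or after a move of
  the cops (second disjunct). Moves after a capture are irrelevant; they exist since
  everybody may stay put.\<close>

definition captured :: "('a list \<Rightarrow> 'a list) \<Rightarrow> (nat \<Rightarrow> 'a) \<Rightarrow> bool" where
  "captured \<sigma> R \<longleftrightarrow>
     (\<exists>t. R t \<in> set (cops_at \<sigma> R t) \<or> R t \<in> set (cops_at \<sigma> R (Suc t)))"

definition winning_cop_strategy ::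
    "'a set \<Rightarrow> 'a set set \<Rightarrow> nat \<Rightarrow> ('a list \<Rightarrow> 'a list) \<Rightarrow> bool" where
  "winning_cop_strategy V E k \<sigma> \<longleftrightarrow>
     cop_strategy V E k \<sigma> \<and> (\<forall>R. robber_play V E R \<longrightarrow> captured \<sigma> R)"

definition bridge_burning_cop_number :: "'a set \<Rightarrow> 'a set set \<Rightarrow> nat" (\<open>c\<^sub>b\<close>) where
  "c\<^sub>b V E = (LEAST k. \<exists>\<sigma>. winning_cop_strategy V E k \<sigma>)"

text \<open>The minimum is attained: a cop on every vertex wins at once.\<close>

lemma winning_cop_strategy_card:
  assumes "finite_graph V E"
  shows "\<exists>\<sigma>. winning_cop_strategy V E (card V) \<sigma>"
proof -
  obtain xs where xs: "set xs = V" "length xs = card V"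
    using assms unfolding finite_graph_def by (metis finite_distinct_list distinct_card)
  have "winning_cop_strategy V E (card V) (\<lambda>_. xs)"
    using xs by (auto simp: winning_cop_strategy_def cop_strategy_def captured_def cops_at_def
        stay_or_move_def robber_play_def intro: list_all2_refl)
  then show ?thesis by blast
qed

end

theory Submission
  imports Defs
begin

text \<open>Place one cop in each clique and keep him there, always on a vertex of his clique threatening
  the robber if there is one. As long as the robber has not entered a clique, no edge meeting a
  clique other than the one he is just using has been deleted, so the cops can move freely inside
  their cliques; hence entering a clique is fatal. Outside the cliques some cop threatens the robber
  after every cop move, so the robber may never stay put and eventually runs out of edges.\<close>

text \<open>Capture has priority. It is the only branch that can take a cop out of \<open>S\<close>,
  so as long as the robber escapes the cop remains in his clique.\<close>

definition cop_step :: "'a set \<Rightarrow> 'a set set \<Rightarrow> 'a \<Rightarrow> 'a \<Rightarrow> 'a" where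
  "cop_step S F c v =
     (if stay_or_move F c v then v
      else if \<exists>u\<in>S. {u, v} \<in> F \<and> stay_or_move F c u
      then SOME u. u \<in> S \<and> {u, v} \<in> F \<and> stay_or_move F c u
      else c)"

lemma cop_step_threat:
  assumes "\<not> stay_or_move F c v" "u \<in> S" "{u, v} \<in> F" "stay_or_move F c u"
  shows "cop_step S F c v \<in> S \<and> {cop_step S F c v, v} \<in> F
    \<and> stay_or_move F c (cop_step S F c v)"
proof -
  have "\<exists>u. u \<in> S \<and> {u, v} \<in> F \<and> stay_or_move F c u"
    using assms by blast
  from someI_ex[OF this] show ?thesis
    using assms by (auto simp: cop_step_def)
qed

lemma stay_or_move_cop_step: "stay_or_move F c (cop_step S F c v)"
proof (cases "\<not> stay_or_move F c v \<and> (\<exists>u\<in>S. {u, v} \<in> F \<and> stay_or_move F c u)")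
  case True
  then show ?thesis using cop_step_threat by metis
next
  case False
  then show ?thesis by (auto simp: cop_step_def stay_or_move_def)
qed

lemma cop_step_in:
  assumes "c \<in> S" "\<not> stay_or_move F c v"
  shows "cop_step S F c v \<in> S"
proof (cases "\<exists>u\<in>S. {u, v} \<in> F \<and> stay_or_move F c u")
  case True
  then show ?thesis using cop_step_threat assms(2) by metis
next
  case False
  then show ?thesis using assms by (auto simp: cop_step_def)
qed

text \<open>The recursion follows a whole robber trajectory rather than a finite history, so that
  \<open>remaining_edges\<close> applies directly.\<close>

primrec cop_path :: "'a set set \<Rightarrow> 'a set \<Rightarrow> 'a \<Rightarrow> (nat \<Rightarrow> 'a) \<Rightarrow> nat \<Rightarrow> 'a" where
  "cop_path E S c R 0 = c"
| "cop_path E S c R (Suc t) =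
     cop_step S (remaining_edges E R t) (cop_path E S c R t) (R t)"

lemma remaining_edges_cong:
  assumes "\<And>s. s \<le> t \<Longrightarrow> R s = R' s"
  shows "remaining_edges E R t = remaining_edges E R' t"
proof -
  have "{R s, R (Suc s)} = {R' s, R' (Suc s)}" if "s < t" for s
    using that assms by simp
  then show ?thesis unfolding remaining_edges_def by blast
qed

text \<open>Shows that the cops do not look ahead: their position after \<open>t\<close> rounds is
  settled by what the robber did before \<open>R t\<close>.\<close>

lemma cop_path_cong:
  assumes "\<And>s. s < t \<Longrightarrow> R s = R' s"
  shows "cop_path E S c R t = cop_path E S c R' t"
  using assms
proof (induction t)
  case (Suc t)
  then have "remaining_edges E R t = remaining_edges E R' t"
    by (intro remaining_edges_cong) simp
  with Suc show ?case by simp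
qed simp

text \<open>The function \<open>(!) h\<close> is unspecified beyond the end of \<open>h\<close>;
  this is harmless, because \<open>cop_path\<close> at \<open>length h\<close> reads only entries of
  \<open>h\<close>.\<close>

definition clique_strategy ::
    "'a set set \<Rightarrow> (nat \<Rightarrow> 'a set) \<Rightarrow> (nat \<Rightarrow> 'a) \<Rightarrow> nat \<Rightarrow> 'a list \<Rightarrow> 'a list" where
  "clique_strategy E S c k h = map (\<lambda>i. cop_path E (S i) (c i) ((!) h) (length h)) [1..<Suc k]"

lemma cops_at_clique_strategy:
  "cops_at (clique_strategy E S c k) R t = map (\<lambda>i. cop_path E (S i) (c i) R t) [1..<Suc k]"
proof -
  have "cop_path E (S i) (c i) ((!) (map R [0..<t])) t = cop_path E (S i) (c i) R t" for i
    by (rule cop_path_cong) simp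
  then show ?thesis by (simp add: cops_at_def clique_strategy_def)
qed

lemma cop_strategy_clique_strategy:
  assumes "\<And>i. i \<in> {1..k} \<Longrightarrow> c i \<in> V"
  shows "cop_strategy V E k (clique_strategy E S c k)"
  unfolding cop_strategy_def
proof (intro conjI allI impI)
  show "length (clique_strategy E S c k []) = k"
    by (simp add: clique_strategy_def)
  show "set (clique_strategy E S c k []) \<subseteq> V"
    using assms by (auto simp: clique_strategy_def)
next
  fix R t
  show "list_all2 (stay_or_move (remaining_edges E R t))
          (cops_at (clique_strategy E S c k) R t) (cops_at (clique_strategy E S c k) R (Suc t))"
    by (simp add: cops_at_clique_strategy list_all2_conv_all_nth stay_or_move_cop_step
        del: upt_Suc)
qed

text \<open>Every deleted edge contains some \<open>R s\<close> with \<open>s < t\<close>. The bound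
  is strict, so \<open>R t\<close> may lie in \<open>e\<close>: the robber may just have arrived
  there.\<close>

lemma remaining_edges_avoided:
  assumes "e \<in> E" "\<And>s. s < t \<Longrightarrow> R s \<notin> e"
  shows "e \<in> remaining_edges E R t"
  using assms by (auto simp: remaining_edges_def)

text \<open>Each genuine move uses an edge different from all those traversed before, so a robber
  who never paused would need infinitely many edges.\<close>

lemma robber_play_stays:
  assumes "finite E" "robber_play V E R"
  obtains t where "R (Suc t) = R t"
proof (rule ccontr)
  assume "\<not> thesis"
  with that have ne: "R (Suc t) \<noteq> R t" for t by blast
  let ?e = "\<lambda>t. {R t, R (Suc t)}"
  have e: "?e t \<in> remaining_edges E R t" for t
    using assms(2) ne[of t] by (auto simp: robber_play_def stay_or_move_def)
  have "?e s \<noteq> ?e t" if "s < t" for s t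
    using e[of t] that unfolding remaining_edges_def by blast
  then have "inj ?e"
    by (intro injI) (metis nat_neq_iff)
  moreover have "range ?e \<subseteq> E"
    using e by (auto simp: remaining_edges_def)
  ultimately show False
    using assms(1) finite_subset range_inj_infinite by blast
qed

lemma captured_clique_strategy:
  assumes fin: "finite E"
    and cl: "\<And>i. i \<in> {1..k} \<Longrightarrow> clique (S i) E"
    and dom: "dominating_set V E (\<Union>i\<in>{1..k}. S i)"
    and c: "\<And>i. i \<in> {1..k} \<Longrightarrow> S i \<noteq> {} \<Longrightarrow> c i \<in> S i"
    and play: "robber_play V E R" and RV: "\<And>t. R t \<in> V"
  shows "captured (clique_strategy E S c k) R"
proof (rule ccontr)
  define D where "D = (\<Union>i\<in>{1..k}. S i)"
  define P where "P i t = cop_path E (S i) (c i) R t" for i t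
  define F where "F t = remaining_edges E R t" for t
  assume "\<not> captured (clique_strategy E S c k) R"
  then have nc: "P i (Suc t) \<noteq> R t" if "i \<in> {1..k}" for i t
    using that unfolding captured_def cops_at_clique_strategy P_def set_map set_upt
      atLeastLessThanSuc_atLeastAtMost image_iff by metis
  have P_Suc: "P i (Suc t) = cop_step (S i) (F t) (P i t) (R t)" for i t
    by (simp add: P_def F_def)
  \<comment> \<open>A cop within reach of the robber would take the capture branch of
    \<open>cop_step\<close> at once.\<close>
  have nm: "\<not> stay_or_move (F t) (P i t) (R t)" if "i \<in> {1..k}" for i t
    using nc[OF that, of t] by (auto simp: P_Suc cop_step_def)
  have in_S: "P i t \<in> S i" if "i \<in> {1..k}" "S i \<noteq> {}" for i t
  proof (induction t)
    case 0
    then show ?case using c that by (simp add: P_def)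
  next
    case (Suc t)
    then show ?case using nm that by (simp add: P_Suc cop_step_in)
  qed
  have in_clique: "stay_or_move (F t) (P i t) u"
    if "\<And>s. s < t \<Longrightarrow> R s \<notin> D" "i \<in> {1..k}" "u \<in> S i" for i t u
  proof (cases "u = P i t")
    case False
    have "P i t \<in> S i" using in_S that by blast
    with False that have "{P i t, u} \<in> E" "{P i t, u} \<subseteq> D"
      using cl[of i] by (auto simp: clique_def D_def)
    with that have "{P i t, u} \<in> F t"
      unfolding F_def by (intro remaining_edges_avoided) blast+
    then show ?thesis by (simp add: stay_or_move_def)
  qed (simp add: stay_or_move_def)
  have nD: "R t \<notin> D" for t
  proof (induction t rule: less_induct)
    case (less t)
    show ?case
    proof
      assume "R t \<in> D"
      then obtain i where "i \<in> {1..k}" "R t \<in> S i" by (auto simp: D_def)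
      \<comment> \<open>At the first visit to \<open>D\<close>, cop \<open>i\<close> can still reach
        every vertex of \<open>S i\<close>, hence also \<open>R t\<close>.\<close>
      with less in_clique nm show False by blast
    qed
  qed
  obtain t where t: "R (Suc t) = R t"
    using robber_play_stays fin play by blast
  \<comment> \<open>The robber pauses outside \<open>D\<close>, so domination supplies a clique with
    a neighbour \<open>u\<close> of \<open>R t\<close>; its cop will exploit the pause.\<close>
  obtain u i where u: "i \<in> {1..k}" "u \<in> S i" "{u, R t} \<in> E"
    using dom RV[of t] nD[of t] unfolding dominating_set_def D_def by blast
  \<comment> \<open>The edge \<open>{u, R t}\<close> meets \<open>D\<close>, but both ends of a deleted edge are outside \<open>D\<close>.\<close>
  have keep: "{w, R t} \<in> F s" if "{w, R t} \<in> E" "w \<in> D" for w s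
  proof -
    have "{w, R t} \<noteq> {R r, R (Suc r)}" for r
      using nD that(2) by (metis doubleton_eq_iff)
    with that(1) show ?thesis by (auto simp: F_def remaining_edges_def)
  qed
  have uD: "u \<in> D" using u by (auto simp: D_def)
  have "P i (Suc t) \<in> S i \<and> {P i (Suc t), R t} \<in> F t"
    using cop_step_threat[OF nm[OF u(1)] u(2) keep[OF u(3) uD] in_clique[OF nD u(1,2)]]
    by (simp add: P_Suc)
  moreover from this have "P i (Suc t) \<in> D" "{P i (Suc t), R t} \<in> E"
    using u by (auto simp: D_def F_def remaining_edges_def)
  \<comment> \<open>The cop made his threat just before the pause, and the threatening edge
    survives, so his next move would be a capture.\<close>
  ultimately have "{P i (Suc t), R (Suc t)} \<in> F (Suc t)"
    using keep t by simp
  with nm[OF u(1), of "Suc t"] show False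
    by (simp add: stay_or_move_def)
qed

lemma robber_play_in_vertices:
  assumes "finite_graph V E" "robber_play V E R"
  shows "R t \<in> V"
proof (induction t)
  case 0
  then show ?case using assms by (simp add: robber_play_def)
next
  case (Suc t)
  have "stay_or_move (remaining_edges E R t) (R t) (R (Suc t))"
    using assms by (simp add: robber_play_def)
  then have "R (Suc t) = R t \<or> {R t, R (Suc t)} \<in> nsets V 2"
    using assms by (auto simp: finite_graph_def stay_or_move_def remaining_edges_def)
  with Suc show ?case by (auto simp: nsets_def)
qed

lemma bridge_burning_cop_number_le:
  assumes "winning_cop_strategy V E k \<sigma>"
  shows "c\<^sub>b V E \<le> k"
  unfolding bridge_burning_cop_number_def using assms by (blast intro: Least_le)

theorem theorem2p2:
  fixes V :: "'a set" and E :: "'a set set" and S :: "nat \<Rightarrow> 'a set" and k :: nat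
  assumes "finite_graph V E"
    and "\<And>i. i \<in> {1..k} \<Longrightarrow> S i \<subseteq> V \<and> clique (S i) E"
    and "dominating_set V E (\<Union>i\<in>{1..k}. S i)"
  shows "c\<^sub>b V E \<le> k"
proof (cases "V = {}")
  case True
  \<comment> \<open>Cops cannot be placed on an empty graph, but no cops are needed either.\<close>
  then have "winning_cop_strategy V E 0 (\<lambda>_. [])"
    by (auto simp: winning_cop_strategy_def cop_strategy_def robber_play_def)
  then show ?thesis
    using bridge_burning_cop_number_le by fastforce
next
  case False
  \<comment> \<open>The cop of an empty clique still needs a starting vertex; any vertex of
    \<open>V\<close> will do.\<close>
  have "\<exists>v. v \<in> V \<and> (S i \<noteq> {} \<longrightarrow> v \<in> S i)" if "i \<in> {1..k}" for i
    using False assms(2)[OF that] by blast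
  then obtain c where c: "\<And>i. i \<in> {1..k} \<Longrightarrow> c i \<in> V \<and> (S i \<noteq> {} \<longrightarrow> c i \<in> S i)"
    by metis
  have fin: "finite E"
    using assms(1) by (meson finite_graph_def finite_imp_finite_nsets finite_subset)
  have "captured (clique_strategy E S c k) R" if "robber_play V E R" for R
    using captured_clique_strategy[OF fin _ assms(3) _ that] c assms(2)
      robber_play_in_vertices[OF assms(1) that] by blast
  moreover have "cop_strategy V E k (clique_strategy E S c k)"
    using c by (intro cop_strategy_clique_strategy) blast
  ultimately have "winning_cop_strategy V E k (clique_strategy E S c k)"
    by (simp add: winning_cop_strategy_def)
  then show ?thesis by (rule bridge_burning_cop_number_le)
qed

end
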